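(* Let $a,b,d\ge 1$ be integers with $\gcd(a,b)=1$, let $B^{\pm}=dab$ and $\mathbf h=(b,-(a+b),a)$. If $t>B^{\pm}$ is an integer with $\gcd(t,d)=1$, then $\mathbf h$ is irreducible in $\mathcal O_t^{\pm}$; and if $t=B^{\pm}$, then $\mathbf h$ is reducible in $\mathcal O_t^{\pm}$. In particular, the lower bound $B^{\pm}$ is optimal (irreducibility of $\mathbf h$ fails at $t=B^{\pm}$).
   Context: For an integer $t\ge da$, $\mathbb L_t=\{(v_0,v_1,v_2)\in\mathbb Z^3:(t-da)v_0+tv_1+(t+db)v_2=0\}$, and $\mathcal O_t^{\pm}=\{\mathbf v\in\mathbb L_t : v_0\ge 0,\ v_2\ge 0\}$ (middle coordinates are then automatically $\le 0$). A nonzero element of $\mathcal O_t^{\pm}$ is reducible if it is a sum of two nonzero elements of $\mathcal O_t^{\pm}$, and irreducible otherwise. *)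

theory Defs
  imports Main "HOL-Library.Product_Plus"
begin

(* Vectors of Z^3 are triples (v0, v1, v2) :: int * int * int, with the componentwise 0, +
   of Product_Plus. The source considers these sets for t >= d * a only. *)

definition lattice_L :: "int \<Rightarrow> int \<Rightarrow> int \<Rightarrow> int \<Rightarrow> (int \<times> int \<times> int) set" where
  "lattice_L a b d t =
     {(v0, v1, v2). (t - d * a) * v0 + t * v1 + (t + d * b) * v2 = 0}"

definition octant_pm :: "int \<Rightarrow> int \<Rightarrow> int \<Rightarrow> int \<Rightarrow> (int \<times> int \<times> int) set" where
  "octant_pm a b d t = {(v0, v1, v2) \<in> lattice_L a b d t. v0 \<ge> 0 \<and> v2 \<ge> 0}"

(* Both notions apply only to nonzero elements of S, so irreducible_in is not the bare
   negation of reducible_in. *)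

definition reducible_in :: "'v::monoid_add set \<Rightarrow> 'v \<Rightarrow> bool" where
  "reducible_in S v \<longleftrightarrow>
     v \<in> S \<and> v \<noteq> 0 \<and> (\<exists>u\<in>S. \<exists>w\<in>S. u \<noteq> 0 \<and> w \<noteq> 0 \<and> v = u + w)"

definition irreducible_in :: "'v::monoid_add set \<Rightarrow> 'v \<Rightarrow> bool" where
  "irreducible_in S v \<longleftrightarrow> v \<in> S \<and> v \<noteq> 0 \<and> \<not> reducible_in S v"

definition B_pm :: "int \<Rightarrow> int \<Rightarrow> int \<Rightarrow> int" where
  "B_pm a b d = d * a * b"

definition h_vec :: "int \<Rightarrow> int \<Rightarrow> int \<times> int \<times> int" where
  "h_vec a b = (b, - (a + b), a)"

end

theory Submission
  imports Defs
begin

text \<open>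
  The equation of the lattice can be regrouped as
  \<open>t (v0 + v1 + v2) = d (a v0 - b v2)\<close>.  Since \<open>t\<close> is coprime to \<open>d\<close>, it divides
  \<open>a v0 - b v2\<close>.  The summands of a decomposition of \<open>\<^bold>h\<close> satisfy \<open>0 \<le> v0 \<le> b\<close> and
  \<open>0 \<le> v2 \<le> a\<close>, so this multiple of \<open>t\<close> has absolute value at most \<open>a b \<le> d a b < t\<close> and
  must vanish.  As \<open>a\<close> and \<open>b\<close> are coprime, \<open>a v0 = b v2\<close> leaves only the corners
  \<open>(0, 0)\<close> and \<open>(b, a)\<close> of the box, where \<open>v0 + v1 + v2 = 0\<close> fixes \<open>v1\<close>; they give
  \<open>0\<close> and \<open>\<^bold>h\<close> (lemma \<open>octant_pm_box\<close>).  Hence no decomposition of \<open>\<^bold>h\<close> has two nonzero summands.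

  At \<open>t = d a b\<close> the other two corners of the box also satisfy the divisibility condition:
  there \<open>d (a v0 - b v2)\<close> equals \<open>t\<close> at \<open>(b, 0)\<close> and \<open>- t\<close> at \<open>(0, a)\<close>, so each
  determines an integral middle coordinate, and the two lattice points add up to \<open>\<^bold>h\<close>.
\<close>

lemma lattice_L_iff:
  "(v0, v1, v2) \<in> lattice_L a b d t \<longleftrightarrow> t * (v0 + v1 + v2) = d * (a * v0 - b * v2)"
  unfolding lattice_L_def by (auto simp: algebra_simps)

lemma h_vec_in_octant_pm:
  assumes "a \<ge> 0" and "b \<ge> 0"
  shows "h_vec a b \<in> octant_pm a b d t"
  using assms by (simp add: octant_pm_def h_vec_def lattice_L_iff)

text \<open>
  Above the bound, the box below \<open>\<^bold>h\<close> is too small for \<open>a v0 - b v2\<close> to be a nonzero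
  multiple of \<open>t\<close>.
\<close>

lemma octant_pm_box:
  fixes a b d t :: int
  assumes "a \<ge> 1" and "b \<ge> 1" and "d \<ge> 1" and "coprime a b"
    and t: "t > d * a * b" and "coprime t d"
    and v: "(v0, v1, v2) \<in> octant_pm a b d t" and "v0 \<le> b" and "v2 \<le> a"
  shows "(v0, v1, v2) = 0 \<or> (v0, v1, v2) = h_vec a b"
proof -
  have eq: "t * (v0 + v1 + v2) = d * (a * v0 - b * v2)" and nonneg: "v0 \<ge> 0" "v2 \<ge> 0"
    using v by (auto simp: octant_pm_def lattice_L_iff)
  have "t dvd d * (a * v0 - b * v2)"
    unfolding eq[symmetric] by simp
  then have t_dvd: "t dvd a * v0 - b * v2"
    using \<open>coprime t d\<close> by (simp add: coprime_dvd_mult_right_iff)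
  have "a * v0 \<le> a * b" "b * v2 \<le> a * b" "0 \<le> a * v0" "0 \<le> b * v2"
    using assms nonneg mult_left_mono[of v2 a b] by (simp_all add: mult.commute)
  moreover have ab_less: "a * b < t"
  proof -
    have "1 * (a * b) \<le> d * (a * b)"
      using assms by (intro mult_right_mono) simp_all
    then show ?thesis using t by (simp add: mult.assoc)
  qed
  ultimately have "\<bar>a * v0 - b * v2\<bar> < t"
    by linarith
  with t_dvd have balanced: "a * v0 = b * v2"
    using dvd_imp_le_int[of "a * v0 - b * v2" t] by linarith
  have "0 < a * b"
    using assms by simp
  then have "t > 0"
    using ab_less by linarith
  then have sum_zero: "v0 + v1 + v2 = 0"
    using eq balanced by simp
  have "b dvd a * v0"
    unfolding balanced by simp
  then have "b dvd v0"
    using \<open>coprime a b\<close> by (simp add: coprime_dvd_mult_right_iff coprime_commute)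
  then have "v0 = 0 \<or> v0 = b"
    using nonneg \<open>v0 \<le> b\<close> zdvd_not_zless[of v0 b] by linarith
  then show ?thesis
  proof
    assume "v0 = 0"
    then show ?thesis
      using balanced sum_zero \<open>b \<ge> 1\<close> by (simp add: zero_prod_def)
  next
    assume "v0 = b"
    then have "b * v2 = b * a"
      using balanced by (simp only: mult.commute)
    then have "v2 = a"
      using \<open>b \<ge> 1\<close> by simp
    then show ?thesis
      using \<open>v0 = b\<close> sum_zero by (simp add: h_vec_def)
  qed
qed

lemma h_vec_irreducible:
  fixes a b d t :: int
  assumes "a \<ge> 1" and "b \<ge> 1" and "d \<ge> 1" and "coprime a b"
    and "t > d * a * b" and "coprime t d"
  shows "irreducible_in (octant_pm a b d t) (h_vec a b)"
proof -
  have False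
    if u: "u \<in> octant_pm a b d t" "u \<noteq> 0" and w: "w \<in> octant_pm a b d t" "w \<noteq> 0"
      and sum: "h_vec a b = u + w" for u w
  proof -
    obtain u0 u1 u2 w0 w1 w2 where uw: "u = (u0, u1, u2)" "w = (w0, w1, w2)"
      by (metis prod.exhaust)
    have "u0 \<ge> 0" "u2 \<ge> 0" "w0 \<ge> 0" "w2 \<ge> 0" "b = u0 + w0" "a = u2 + w2"
      using u w sum by (auto simp: uw octant_pm_def h_vec_def)
    then have "u = h_vec a b"
      using octant_pm_box[OF assms, of u0 u1 u2] u by (simp add: uw)
    then show False
      using sum w by simp
  qed
  moreover have "h_vec a b \<noteq> 0"
    using assms by (simp add: h_vec_def zero_prod_def)
  moreover have "h_vec a b \<in> octant_pm a b d t"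
    using assms by (intro h_vec_in_octant_pm) simp_all
  ultimately show ?thesis
    unfolding irreducible_in_def reducible_in_def by blast
qed

lemma h_vec_reducible_at_bound:
  fixes a b d :: int
  assumes "a \<ge> 1" and "b \<ge> 1"
  shows "reducible_in (octant_pm a b d (d * a * b)) (h_vec a b)"
proof -
  define u w :: "int \<times> int \<times> int" where "u = (b, 1 - b, 0)" and "w = (0, - (a + 1), a)"
  have "u \<in> octant_pm a b d (d * a * b)" "w \<in> octant_pm a b d (d * a * b)"
    using assms by (simp_all add: u_def w_def octant_pm_def lattice_L_iff)
  moreover have "u \<noteq> 0" "w \<noteq> 0" "h_vec a b = u + w" "h_vec a b \<noteq> 0"
    using assms by (simp_all add: u_def w_def h_vec_def zero_prod_def)
  moreover have "h_vec a b \<in> octant_pm a b d (d * a * b)"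
    using assms by (intro h_vec_in_octant_pm) simp_all
  ultimately show ?thesis
    unfolding reducible_in_def by blast
qed

theorem proposition3p2:
  fixes a b d :: int
  assumes "a \<ge> 1" and "b \<ge> 1" and "d \<ge> 1" and "gcd a b = 1"
  shows "(\<forall>t::int. t > B_pm a b d \<and> gcd t d = 1 \<longrightarrow>
            irreducible_in (octant_pm a b d t) (h_vec a b))
       \<and> (\<forall>t::int. t = B_pm a b d \<longrightarrow>
            reducible_in (octant_pm a b d t) (h_vec a b))
       \<and> \<not> irreducible_in (octant_pm a b d (B_pm a b d)) (h_vec a b)"
proof -
  have "coprime a b"
    using assms by (simp only: coprime_iff_gcd_eq_1)
  then have "irreducible_in (octant_pm a b d t) (h_vec a b)"
    if "t > B_pm a b d" "gcd t d = 1" for t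
    using that assms h_vec_irreducible[of a b d t]
    by (simp only: B_pm_def coprime_iff_gcd_eq_1)
  moreover have "reducible_in (octant_pm a b d (B_pm a b d)) (h_vec a b)"
    unfolding B_pm_def using assms by (intro h_vec_reducible_at_bound)
  moreover from this have "\<not> irreducible_in (octant_pm a b d (B_pm a b d)) (h_vec a b)"
    by (simp only: irreducible_in_def not_True_eq_False simp_thms)
  ultimately show ?thesis
    by (intro conjI allI impI) (simp_all only: simp_thms)
qed

end
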